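(* Let $\alpha,\eta>0$ and $\delta\in(0,\tfrac12)$. Any learning algorithm that $(\alpha,\delta)$-learns, with respect to $\mathcal{H}_\Box$, all distributions $D$ over $\mathbb{R}_+^d\times\{-1,+1\}$ with $\mathrm{err}(D,\mathcal{H}_\Box)=\eta$ has active label complexity $\Omega(d/\eta)$.
   Context: Setting: an algorithm may draw i.i.d. pairs $(X,Y)\sim D$; it sees $X$ but $Y$ is hidden until queried; the active label complexity is the total number of label queries. An algorithm $(\alpha,\delta)$-learns $D$ w.r.t. $\mathcal{H}$ if with probability at least $1-\delta$ the returned $\hat h$ satisfies $\mathrm{err}(D,\hat h)\le(1+\alpha)\mathrm{err}(D,\mathcal{H})$, where $\mathrm{err}(D,h)=\Pr_{(X,Y)\sim D}[h(X)\ne Y]$ and $\mathrm{err}(D,\mathcal{H})=\min_{h\in\mathcal{H}}\mathrm{err}(D,h)$. For $\mathbf a\in\mathbb{R}_+^d$, $h_{\mathbf a}(x)=2\mathbb{I}[\exists i\in[d],\ x[i]\ge a[i]]-1$; $\mathcal{H}_\Box=\{h_{\mathbf a}:\mathbf a\in\mathbb{R}_+^d\}$. *)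

theory Defs
  imports "HOL-Probability.Probability"
begin

text \<open>Points of R_+^d are encoded as functions nat => real that are nonnegative on
coordinates i < d and zero on coordinates i >= d.  Labels are integers in {-1, 1}.\<close>

type_synonym point = "nat \<Rightarrow> real"

definition orthant :: "nat \<Rightarrow> point set" where
  "orthant d = {x. (\<forall>i<d. 0 \<le> x i) \<and> (\<forall>i. d \<le> i \<longrightarrow> x i = 0)}"

definition h_box :: "nat \<Rightarrow> point \<Rightarrow> point \<Rightarrow> int" where
  "h_box d a x = 2 * (if \<exists>i<d. x i \<ge> a i then 1 else 0) - 1"

definition H_box :: "nat \<Rightarrow> (point \<Rightarrow> int) set" where
  "H_box d = {h_box d a | a. a \<in> orthant d}"

definition example_space :: "(point \<times> int) measure" where
  "example_space = (\<Pi>\<^sub>M i\<in>UNIV. (borel :: real measure)) \<Otimes>\<^sub>M count_space UNIV"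

definition err :: "(point \<times> int) measure \<Rightarrow> (point \<Rightarrow> int) \<Rightarrow> real" where
  "err D h = measure D {z \<in> space D. h (fst z) \<noteq> snd z}"

definition err_class :: "(point \<times> int) measure \<Rightarrow> (point \<Rightarrow> int) set \<Rightarrow> real" where
  "err_class D H = (INF h\<in>H. err D h)"

definition valid_dist :: "nat \<Rightarrow> (point \<times> int) measure \<Rightarrow> bool" where
  "valid_dist d D \<longleftrightarrow> prob_space D \<and> sets D = sets example_space \<and>
     (AE z in D. fst z \<in> orthant d \<and> snd z \<in> {-1, 1})"

text \<open>Active learning algorithm with random seed w (drawn from a probability measure R).
It sees the whole unlabelled i.i.d. stream xs (X_0, X_1, ...); the labels ys are hidden.
Adaptively, q w xs ls gives the index of the next label to query given the labels ls
revealed so far (None = stop).  With label budget m, at most m queries are made.\<close>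
primrec queried ::
  "(real \<Rightarrow> (nat \<Rightarrow> point) \<Rightarrow> int list \<Rightarrow> nat option) \<Rightarrow> real \<Rightarrow> (nat \<Rightarrow> point) \<Rightarrow>
     (nat \<Rightarrow> int) \<Rightarrow> nat \<Rightarrow> int list" where
  "queried q w xs ys 0 = []"
| "queried q w xs ys (Suc k) =
     (let ls = queried q w xs ys k in
       (case q w xs ls of None \<Rightarrow> ls | Some i \<Rightarrow> ls @ [ys i]))"

text \<open>The algorithm (R, q, out) with label budget m (alpha,delta)-learns D w.r.t. H:
with probability at least 1 - delta (over the seed and the i.i.d. sample stream), the
returned hypothesis h has (measurable error event and) err(D,h) <= (1+alpha) err(D,H).
Probability is taken as inner probability (a measurable subevent of prob >= 1 - delta).\<close>
definition al_learns ::
  "real measure \<Rightarrow> (real \<Rightarrow> (nat \<Rightarrow> point) \<Rightarrow> int list \<Rightarrow> nat option) \<Rightarrow>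
   (real \<Rightarrow> (nat \<Rightarrow> point) \<Rightarrow> int list \<Rightarrow> (point \<Rightarrow> int)) \<Rightarrow> nat \<Rightarrow>
   (point \<Rightarrow> int) set \<Rightarrow> real \<Rightarrow> real \<Rightarrow> (point \<times> int) measure \<Rightarrow> bool" where
  "al_learns R q out m H \<alpha> \<delta> D \<longleftrightarrow>
     (\<exists>E \<in> sets (R \<Otimes>\<^sub>M stream_space D).
        E \<subseteq> {(w, s). let xs = (\<lambda>i. fst (s !! i)); ys = (\<lambda>i. snd (s !! i));
                          h = out w xs (queried q w xs ys m)
                      in {z \<in> space D. h (fst z) \<noteq> snd z} \<in> sets D \<and>
                         err D h \<le> (1 + \<alpha>) * err_class D H}
        \<and> measure (R \<Otimes>\<^sub>M stream_space D) E \<ge> 1 - \<delta>)"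

end

theory Submission
  imports Defs
begin

text \<open>Pair up the coordinates into \<open>B = d div 2\<close> blocks, and in the plane of each block take \<open>N\<close>
points on an antidiagonal. The corner of the box can be chosen so that exactly one arbitrarily
prescribed point \<open>\<sigma> b\<close> of every block \<open>b\<close> is labelled negative. Give each of the \<open>B * N\<close> points mass
\<open>p = 2 (1 + \<alpha>) \<eta> / B\<close> with \<open>N\<close> of order \<open>1 / ((1 + \<alpha>) \<eta>)\<close>, and put the remaining mass on the
origin with a noisy label, which makes the best error exactly \<open>\<eta>\<close>. A hypothesis with error at most
\<open>(1 + \<alpha>) \<eta>\<close> identifies \<open>\<sigma> b\<close> in at least half of the blocks.
For a uniformly random \<open>\<sigma>\<close>, conditionally on the seed, the unlabelled stream and the noise,
\<open>m\<close> queries identify on average at most \<open>2 (B + m) / N\<close> of the \<open>\<sigma> b\<close>; so \<open>m\<close> is of order at least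
\<open>B * N\<close>.\<close>

section \<open>I.i.d. streams and push-forward measures\<close>

text \<open>Integrating out the head of the stream peels off one factor at a time. Cylinders
  generate the stream space, so these values determine the law of an i.i.d. stream.\<close>

lemma (in prob_space) emeasure_stream_space_scylinder:
  assumes "\<forall>A\<in>set As. A \<in> sets M"
  shows "emeasure (stream_space M) (scylinder (space M) As) = prod_list (map (emeasure M) As)"
  using assms
proof (induction As)
  case Nil
  interpret S: prob_space "stream_space M" by (rule prob_space_stream_space)
  show ?case using S.emeasure_space_1 by (simp add: space_stream_space)
next
  case (Cons A As)
  hence A: "A \<in> sets M" and As: "scylinder (space M) As \<in> sets (stream_space M)"
    by (auto intro: sets_scylinder)
  have "emeasure (stream_space M) (scylinder (space M) (A # As))
      = (\<integral>\<^sup>+t. emeasure (stream_space M)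
            {x\<in>space (stream_space M). t ## x \<in> scylinder (space M) (A # As)} \<partial>M)"
    using Cons.prems by (intro emeasure_stream_space sets_scylinder) auto
  also have "\<dots> = (\<integral>\<^sup>+t. emeasure (stream_space M) (scylinder (space M) As) * indicator A t \<partial>M)"
  proof (intro nn_integral_cong)
    fix t assume "t \<in> space M"
    hence "{x\<in>space (stream_space M). t ## x \<in> scylinder (space M) (A # As)}
        = (if t \<in> A then scylinder (space M) As else {})"
      using scylinder_streams[of "space M" As] by (auto simp: space_stream_space)
    thus "emeasure (stream_space M) {x\<in>space (stream_space M). t ## x \<in> scylinder (space M) (A # As)}
        = emeasure (stream_space M) (scylinder (space M) As) * indicator A t" by simp
  qed
  also have "\<dots> = emeasure (stream_space M) (scylinder (space M) As) * emeasure M A"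
    using A by (simp add: nn_integral_cmult_indicator)
  finally show ?case using Cons by (simp add: mult.commute)
qed

text \<open>The preimage of a cylinder under \<open>smap f\<close> is the cylinder of the preimages,
  and both measures are determined by their values on cylinders. This lets the sample streams of all
  hard distributions be realised on one probability space.\<close>

lemma (in prob_space) stream_space_distr:
  assumes f[measurable]: "f \<in> M \<rightarrow>\<^sub>M N"
  shows "stream_space (distr M N f) = distr (stream_space M) (stream_space N) (smap f)"
proof (rule stream_space_eq_scylinder[where S = N and G = "sets N" and C = "{space N}"])
  interpret S: prob_space "stream_space M" by (rule prob_space_stream_space)
  interpret D: prob_space "distr M N f" by (rule prob_space_distr) fact
  show "prob_space (stream_space (distr M N f))" by (rule D.prob_space_stream_space)
  show "prob_space (distr (stream_space M) (stream_space N) (smap f))"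
    by (rule S.prob_space_distr) measurable
  show "sets N = sets (sigma (space N) (sets N))" by simp
  show "sets (stream_space (distr M N f)) = sets (stream_space N)"
    by (rule sets_stream_space_cong) simp
  fix As assume "As \<in> lists (sets N)"
  hence As: "\<forall>A\<in>set As. A \<in> sets N" by auto
  have "emeasure (stream_space (distr M N f)) (scylinder (space N) As)
      = prod_list (map (emeasure (distr M N f)) As)"
    using D.emeasure_stream_space_scylinder[of As] As by simp
  also have "\<dots> = prod_list (map (emeasure M) (map (\<lambda>A. f -` A \<inter> space M) As))"
    using As by (simp add: emeasure_distr comp_def cong: map_cong)
  also have "\<dots> = emeasure (stream_space M) (scylinder (space M) (map (\<lambda>A. f -` A \<inter> space M) As))"
    using As by (intro emeasure_stream_space_scylinder[symmetric]) auto
  also have "scylinder (space M) (map (\<lambda>A. f -` A \<inter> space M) As)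
      = smap f -` scylinder (space N) As \<inter> space (stream_space M)"
  proof -
    have "s \<in> scylinder (space M) (map (\<lambda>A. f -` A \<inter> space M) As)
        \<longleftrightarrow> smap f s \<in> scylinder (space N) As" if "s \<in> streams (space M)" for s
      using that
    proof (induction As arbitrary: s)
      case Nil
      thus ?case using smap_streams[of s "space M" f "space N"] measurable_space[OF f] by auto
    next
      case (Cons A As)
      have "shd s \<in> space M" "stl s \<in> streams (space M)" "smap f s \<in> streams (space N)"
        using Cons.prems smap_streams[of s "space M" f "space N"] measurable_space[OF f]
        by (auto simp: streams_stl streams_shd)
      thus ?case using Cons by simp
    qed
    thus ?thesis using scylinder_streams[of "space M"] by (auto simp: space_stream_space)
  qed
  also have "emeasure (stream_space M) \<dots>
      = emeasure (distr (stream_space M) (stream_space N) (smap f)) (scylinder (space N) As)"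
    using As by (intro emeasure_distr[symmetric] sets_scylinder) auto
  finally show "emeasure (stream_space (distr M N f)) (scylinder (space N) As)
      = emeasure (distr (stream_space M) (stream_space N) (smap f)) (scylinder (space N) As)" .
qed (auto simp: sets.Int_stable sets.space_closed)

section \<open>The adaptive guessing game for a hidden \<open>\<sigma>\<close>\<close>

text \<open>\<open>queried\<close> recurses on the last query. Peeling off the first one instead
  allows an induction that conditions on the first answer and continues with a modified
  strategy.\<close>

lemma queried_Suc_Cons:
  assumes "q w xs [] = Some i"
  shows "queried q w xs ys (Suc k) =
    ys i # queried (\<lambda>w xs ls. q w xs (ys i # ls)) w xs ys k"
proof (induction k)
  case (Suc k)
  then show ?case
    by (subst queried.simps(2), subst Suc.IH) (simp add: Let_def split: option.split)
qed (simp add: assms)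

lemma queried_Nil:
  assumes "q w xs [] = None"
  shows "queried q w xs ys k = []"
  using assms by (induction k) auto

text \<open>The left summand carries all information on \<open>\<sigma>\<close>. In the right
  summand the label is part of the outcome, so querying it reveals nothing about
  \<open>\<sigma>\<close>.\<close>

fun planted_label :: "('b \<Rightarrow> 'k) \<Rightarrow> ('b \<times> 'k) + bool \<Rightarrow> int" where
  "planted_label \<sigma> (Inl (b, k)) = (if \<sigma> b = k then -1 else 1)"
| "planted_label \<sigma> (Inr z) = (if z then 1 else -1)"

lemma card_PiE_split:
  assumes "finite I" "b \<in> I"
  shows "card (PiE I A) = card (A b) * (\<Prod>c\<in>I - {b}. card (A c))"
  using assms by (simp add: card_PiE prod.remove)

lemma card_PiE_upd:
  assumes "finite I" "b \<in> I"
  shows "card (PiE I (A(b := S))) = card S * (\<Prod>c\<in>I - {b}. card (A c))"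
  unfolding card_PiE_split[OF assms] by (intro arg_cong2[where f = "(*)"] prod.cong) auto

text \<open>A block with \<open>n\<close> remaining candidates gets the potential \<open>1 + (2 - n) / N\<close>.  It dominates the
probability \<open>1 / n\<close> of a correct blind guess, and it is chosen so that a query, which either
singles out one candidate (probability \<open>1 / n\<close>) or discards it, raises its mean by at most
\<open>2 / N\<close>.\<close>

lemma sum_correct_guess_le:
  fixes A :: "'b \<Rightarrow> 'k set" and N :: real
  assumes fin: "finite I" and A: "\<And>b. b \<in> I \<Longrightarrow> finite (A b) \<and> A b \<noteq> {} \<and> card (A b) \<le> N"
  shows "(\<Sum>\<sigma>\<in>PiE I A. real (card {b\<in>I. g b = \<sigma> b}))
      \<le> real (card (PiE I A)) * (\<Sum>b\<in>I. 1 + (2 - real (card (A b))) / N)"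
proof -
  have finP: "finite (PiE I A)" using fin A by (intro finite_PiE) auto
  have "(\<Sum>\<sigma>\<in>PiE I A. real (card {b\<in>I. g b = \<sigma> b}))
      = (\<Sum>\<sigma>\<in>PiE I A. \<Sum>b\<in>I. if g b = \<sigma> b then 1 else 0)"
    using fin by (intro sum.cong) (simp_all add: sum.If_cases Int_def)
  also have "\<dots> = (\<Sum>b\<in>I. \<Sum>\<sigma>\<in>PiE I A. if g b = \<sigma> b then 1 else 0)"
    by (rule sum.swap)
  also have "\<dots> = (\<Sum>b\<in>I. real (card {\<sigma>\<in>PiE I A. \<sigma> b = g b}))"
    using finP by (intro sum.cong) (simp_all add: sum.If_cases Int_def eq_commute)
  also have "\<dots> \<le> (\<Sum>b\<in>I. real (card (PiE I A)) * (1 + (2 - real (card (A b))) / N))"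
  proof (rule sum_mono)
    fix b assume b: "b \<in> I"
    define P where "P = (\<Prod>c\<in>I - {b}. card (A c))"
    define n where "n = real (card (A b))"
    have n: "1 \<le> n" "n \<le> N" using A[OF b] by (auto simp: n_def Suc_le_eq card_gt_0_iff)
    \<comment> \<open>Only an inclusion, since \<open>g b\<close> may lie outside
      \<open>A b\<close>.\<close>
    have "{\<sigma>\<in>PiE I A. \<sigma> b = g b} \<subseteq> PiE I (A(b := {g b}))"
      by (auto simp: PiE_iff extensional_def)
    moreover have "finite (PiE I (A(b := {g b})))" using fin A by (intro finite_PiE) auto
    ultimately have "card {\<sigma>\<in>PiE I A. \<sigma> b = g b} \<le> card (PiE I (A(b := {g b})))"
      by (intro card_mono)
    also have "\<dots> = P" by (simp add: card_PiE_upd[OF fin b] P_def)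
    finally have "card {\<sigma>\<in>PiE I A. \<sigma> b = g b} \<le> P" .
    hence "real (card {\<sigma>\<in>PiE I A. \<sigma> b = g b}) \<le> real P" by simp
    also have "\<dots> \<le> real P * (n * (1 + (2 - n) / N))"
    proof -
      \<comment> \<open>This is the inequality \<open>1 \<le> n * (1 + (2 - n) / N)\<close>
        multiplied by \<open>N\<close>: the potential dominates \<open>1 / n\<close>.\<close>
      have "0 \<le> (n - 1) * (N - n) + n" using n by (intro add_nonneg_nonneg mult_nonneg_nonneg) auto
      also have "\<dots> = N * n + 2*n - n * n - N" by (simp add: algebra_simps)
      finally have "1 \<le> n * (1 + (2 - n) / N)" using n by (simp add: field_simps)
      thus ?thesis using mult_left_mono[of 1 _ "real P"] by simp
    qed
    also have "\<dots> = real (card (PiE I A)) * (1 + (2 - n) / N)"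
      by (simp add: card_PiE_split[OF fin b] P_def n_def)
    finally show "real (card {\<sigma>\<in>PiE I A. \<sigma> b = g b}) \<le>
        real (card (PiE I A)) * (1 + (2 - real (card (A b))) / N)" by (simp add: n_def)
  qed
  finally show ?thesis by (simp add: sum_distrib_left)
qed

text \<open>Induction on the number of queries, with the strategy and the candidate sets
  generalised. After either answer to the first query the consistent \<open>\<sigma>\<close> again
  form a product set, so the induction hypothesis applies to each answer separately and only the
  change in potential has to be computed.\<close>

lemma sum_correct_guess_adaptive_le:
  fixes A :: "'b \<Rightarrow> 'k set" and N :: real
  assumes fin: "finite I" and A: "\<And>b. b \<in> I \<Longrightarrow> finite (A b) \<and> A b \<noteq> {} \<and> card (A b) \<le> N"
    and N: "0 < N"
  shows "(\<Sum>\<sigma>\<in>PiE I A. real (card {b\<in>I. g (queried q w xs (\<lambda>i. planted_label \<sigma> (loc i)) m) b = \<sigma> b}))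
      \<le> real (card (PiE I A)) * ((\<Sum>b\<in>I. 1 + (2 - real (card (A b))) / N) + 2 * real m / N)"
  using A
proof (induction m arbitrary: A q g)
  case 0
  show ?case using sum_correct_guess_le[OF fin 0, where g = "g []"] by simp
next
  case (Suc m)
  note A = Suc.prems
  let ?f = "\<lambda>n::nat. 1 + (2 - real n) / N"
  let ?right = "\<lambda>q g m \<sigma>. real (card {b\<in>I. g (queried q w xs (\<lambda>i. planted_label \<sigma> (loc i)) m) b = \<sigma> b})"
  show ?case
  proof (cases "q w xs []")
    case None
    have "(\<Sum>\<sigma>\<in>PiE I A. ?right q g (Suc m) \<sigma>) \<le> real (card (PiE I A)) * (\<Sum>b\<in>I. ?f (card (A b)))"
      using sum_correct_guess_le[OF fin A, where g = "g []"] by (simp only: queried_Nil[of q w xs, OF None])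
    also have "\<dots> \<le> real (card (PiE I A)) * ((\<Sum>b\<in>I. ?f (card (A b))) + 2 * real (Suc m) / N)"
      using N by (intro mult_left_mono) auto
    finally show ?thesis .
  next
    case (Some i)
    let ?q = "\<lambda>y w xs ls. q w xs (y # ls)" and ?g = "\<lambda>y ls. g (y # ls)"
    have first: "?right q g (Suc m) \<sigma> = ?right (?q y) (?g y) m \<sigma>" if "planted_label \<sigma> (loc i) = y" for \<sigma> y
      using queried_Suc_Cons[of q w xs i "\<lambda>i. planted_label \<sigma> (loc i)" m, OF Some] that by simp
    \<comment> \<open>A first query with the same answer for all remaining \<open>\<sigma>\<close>
      is wasted: the candidate sets stay as they are.\<close>
    have const: ?thesis if y: "\<And>\<sigma>. \<sigma> \<in> PiE I A \<Longrightarrow> planted_label \<sigma> (loc i) = y" for y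
    proof -
      have "(\<Sum>\<sigma>\<in>PiE I A. ?right q g (Suc m) \<sigma>) = (\<Sum>\<sigma>\<in>PiE I A. ?right (?q y) (?g y) m \<sigma>)"
        using first y by (intro sum.cong) auto
      also have "\<dots> \<le> real (card (PiE I A)) * ((\<Sum>b\<in>I. ?f (card (A b))) + 2 * real m / N)"
        by (rule Suc.IH[OF A])
      also have "\<dots> \<le> real (card (PiE I A)) * ((\<Sum>b\<in>I. ?f (card (A b))) + 2 * real (Suc m) / N)"
        using N by (intro mult_left_mono add_left_mono divide_right_mono) auto
      finally show ?thesis .
    qed
    show ?thesis
    proof (cases "\<exists>b k. loc i = Inl (b, k) \<and> b \<in> I \<and> k \<in> A b \<and> A b \<noteq> {k}")
      case False
      show ?thesis
      proof (cases "loc i")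
        case (Inr z)
        thus ?thesis by (intro const[of "if z then 1 else -1"]) simp
      next
        case (Inl p)
        obtain b k where bk: "loc i = Inl (b, k)" using Inl by (cases p) auto
        consider "b \<notin> I" | "b \<in> I" "k \<notin> A b" | "b \<in> I" "A b = {k}" using False bk by blast
        thus ?thesis
        proof cases
          case 1
          \<comment> \<open>Members of \<open>PiE I A\<close> take the value
            \<open>undefined\<close> outside \<open>I\<close>.\<close>
          thus ?thesis by (intro const[of "if undefined = k then -1 else 1"]) (auto simp: bk PiE_iff extensional_def)
        next
          case 2
          thus ?thesis by (intro const[of 1]) (auto simp: bk PiE_iff)
        next
          case 3
          thus ?thesis by (intro const[of "-1"]) (auto simp: bk PiE_iff)
        qed
      qed
    next
      case True
      then obtain b k where bk: "loc i = Inl (b, k)" "b \<in> I" "k \<in> A b" "A b \<noteq> {k}" by blast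
      \<comment> \<open>The informative case: a negative answer leaves \<open>A1\<close>, a positive
        one leaves \<open>A2\<close>. The latter is nonempty because \<open>A b\<close> has a
        candidate other than \<open>k\<close>.\<close>
      define A1 where "A1 = A(b := {k})"
      define A2 where "A2 = A(b := A b - {k})"
      define P where "P = real (\<Prod>c\<in>I - {b}. card (A c))"
      have P0: "0 \<le> P" unfolding P_def by (rule of_nat_0_le_iff)
      define S where "S = (\<Sum>c\<in>I - {b}. ?f (card (A c))) + 2 * real m / N"
      define n where "n = real (card (A b))"
      have fA: "finite (A b)" using A bk by auto
      have split: "PiE I A = PiE I A1 \<union> PiE I A2" "PiE I A1 \<inter> PiE I A2 = {}"
        using bk unfolding A1_def A2_def by (auto simp: PiE_iff split: if_splits)
      have A1: "finite (A1 c) \<and> A1 c \<noteq> {} \<and> card (A1 c) \<le> N" if "c \<in> I" for c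
      proof -
        have "1 \<le> card (A b)" using A bk by (auto simp: Suc_le_eq card_gt_0_iff)
        hence "1 \<le> N" using A[OF bk(2)] by linarith
        thus ?thesis using A[OF that] by (auto simp: A1_def)
      qed
      have A2: "finite (A2 c) \<and> A2 c \<noteq> {} \<and> card (A2 c) \<le> N" if "c \<in> I" for c
      proof -
        have "real (card (A b - {k})) \<le> real (card (A b))" using fA by (simp add: card_mono)
        hence "card (A b - {k}) \<le> N" using A[OF bk(2)] by linarith
        thus ?thesis using A[OF that] bk by (auto simp: A2_def)
      qed
      have fin1: "finite (PiE I A1)" and fin2: "finite (PiE I A2)"
        using fin A1 A2 by (auto intro!: finite_PiE)
      have c0: "real (card (PiE I A)) = P * n"
        using card_PiE_split[OF fin bk(2), of A] by (simp add: P_def n_def)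
      have c1: "real (card (PiE I A1)) = P"
        using card_PiE_upd[OF fin bk(2), of A "{k}"] by (simp add: P_def A1_def)
      have cA2: "real (card (A b - {k})) = n - 1"
        using card_Suc_Diff1[OF fA bk(3)] by (simp add: n_def)
      have c2: "real (card (PiE I A2)) = P * (n - 1)"
        using card_PiE_upd[OF fin bk(2), of A "A b - {k}"] cA2 by (simp add: P_def A2_def)
      have s0: "(\<Sum>c\<in>I. ?f (card (A c))) + 2 * real m / N = S + 1 + (2 - n) / N"
        using fin bk by (simp add: S_def n_def sum.remove[of I b])
      have s1: "(\<Sum>c\<in>I. ?f (card (A1 c))) + 2 * real m / N = S + 1 + 1 / N"
        using fin bk by (simp add: S_def A1_def sum.remove[of I b])
      have s2: "(\<Sum>c\<in>I. ?f (card (A2 c))) + 2 * real m / N = S + 1 + (3 - n) / N"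
        using fin bk cA2 by (simp add: S_def A2_def sum.remove[of I b])
      have "(\<Sum>\<sigma>\<in>PiE I A. ?right q g (Suc m) \<sigma>)
          = (\<Sum>\<sigma>\<in>PiE I A1. ?right q g (Suc m) \<sigma>) + (\<Sum>\<sigma>\<in>PiE I A2. ?right q g (Suc m) \<sigma>)"
        unfolding split(1) by (rule sum.union_disjoint[OF fin1 fin2 split(2)])
      also have "(\<Sum>\<sigma>\<in>PiE I A1. ?right q g (Suc m) \<sigma>) = (\<Sum>\<sigma>\<in>PiE I A1. ?right (?q (-1)) (?g (-1)) m \<sigma>)"
        using bk by (intro sum.cong refl first) (auto simp: A1_def PiE_iff split: if_splits)
      also have "(\<Sum>\<sigma>\<in>PiE I A2. ?right q g (Suc m) \<sigma>) = (\<Sum>\<sigma>\<in>PiE I A2. ?right (?q 1) (?g 1) m \<sigma>)"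
        using bk by (intro sum.cong refl first) (auto simp: A2_def PiE_iff split: if_splits)
      also have "(\<Sum>\<sigma>\<in>PiE I A1. ?right (?q (-1)) (?g (-1)) m \<sigma>) + (\<Sum>\<sigma>\<in>PiE I A2. ?right (?q 1) (?g 1) m \<sigma>)
          \<le> P * (S + 1 + 1 / N) + P * (n - 1) * (S + 1 + (3 - n) / N)"
        using Suc.IH[where A = A1, OF A1, where g = "?g (-1)" and q = "?q (-1)"]
          Suc.IH[where A = A2, OF A2, where g = "?g 1" and q = "?q 1"]
        unfolding c1 c2 s1 s2 by (rule add_mono)
      \<comment> \<open>Divided by \<open>P * n\<close>, this says that the query raises the mean
        potential by exactly \<open>2 / N - 2 / (n * N)\<close>.\<close>
      also have "\<dots> = P * n * (S + 1 + (2 - n) / N + 2 / N) - 2 * P / N"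
      proof -
        have "1 / N + (n - 1) * ((3 - n) / N) = n * ((2 - n) / N + 2 / N) - 2 / N"
          using N by (simp add: field_simps)
        hence "P * (1 / N + (n - 1) * ((3 - n) / N)) = P * (n * ((2 - n) / N + 2 / N) - 2 / N)"
          by simp
        thus ?thesis by (simp only: ring_distribs mult.assoc) (simp add: algebra_simps)
      qed
      also have "\<dots> \<le> P * n * (S + 1 + (2 - n) / N + 2 / N)"
        using N P0 by simp
      also have "\<dots> = real (card (PiE I A)) * ((\<Sum>b\<in>I. ?f (card (A b))) + 2 * real (Suc m) / N)"
        using s0 by (simp add: c0 add_divide_distrib algebra_simps)
      finally show ?thesis .
    qed
  qed
qed

section \<open>Averaging over events, and transport of the learning guarantee\<close>

text \<open>The sum is the expected number of events that contain the sampled point. With one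
  success event per \<open>\<sigma>\<close>, this permits counting the \<open>\<sigma>\<close> while
  seed and stream are held fixed.\<close>

lemma (in prob_space) sum_prob_le:
  assumes S: "finite S" and F: "\<And>\<sigma>. \<sigma> \<in> S \<Longrightarrow> F \<sigma> \<in> events"
    and c: "\<And>x. x \<in> space M \<Longrightarrow> real (card {\<sigma>\<in>S. x \<in> F \<sigma>}) \<le> c"
  shows "(\<Sum>\<sigma>\<in>S. prob (F \<sigma>)) \<le> c"
proof -
  have "(\<Sum>\<sigma>\<in>S. prob (F \<sigma>)) = (\<Sum>\<sigma>\<in>S. expectation (indicat_real (F \<sigma>)))"
    using F by (intro sum.cong) (auto simp: Int_absorb2 sets.sets_into_space)
  also have "\<dots> = expectation (\<lambda>x. \<Sum>\<sigma>\<in>S. indicat_real (F \<sigma>) x)"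
    using F by (intro Bochner_Integration.integral_sum[symmetric]) (auto simp: emeasure_eq_measure)
  also have "\<dots> \<le> expectation (\<lambda>x. c)"
  proof (rule integral_mono)
    show "integrable M (\<lambda>x. \<Sum>\<sigma>\<in>S. indicat_real (F \<sigma>) x)"
      using F by (auto simp: emeasure_eq_measure)
    fix x assume "x \<in> space M"
    have "(\<Sum>\<sigma>\<in>S. indicat_real (F \<sigma>) x) = real (card {\<sigma>\<in>S. x \<in> F \<sigma>})"
      using S by (simp add: indicator_def sum.If_cases Int_def)
    thus "(\<Sum>\<sigma>\<in>S. indicat_real (F \<sigma>) x) \<le> c" using c[OF \<open>x \<in> space M\<close>] by simp
  qed simp
  finally show ?thesis by (simp add: prob_space)
qed

text \<open>The success event is pulled back along \<open>smap f\<close>. For different labelings of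
  the same outcomes the resulting events then live on one space and can be compared.\<close>

lemma al_learns_distrE:
  assumes "prob_space M" "prob_space R" and f[measurable]: "f \<in> M \<rightarrow>\<^sub>M N"
    and "al_learns R q out m H \<alpha> \<delta> (distr M N f)"
  obtains F where "F \<in> sets (R \<Otimes>\<^sub>M stream_space M)" "measure (R \<Otimes>\<^sub>M stream_space M) F \<ge> 1 - \<delta>"
    "\<And>w s h. (w, s) \<in> F \<Longrightarrow>
       h = out w (\<lambda>i. fst (f (s !! i)))
             (queried q w (\<lambda>i. fst (f (s !! i))) (\<lambda>i. snd (f (s !! i))) m) \<Longrightarrow>
       {z \<in> space N. h (fst z) \<noteq> snd z} \<in> sets N \<and> err (distr M N f) h \<le> (1 + \<alpha>) * err_class (distr M N f) H"
proof -
  interpret M: prob_space M by fact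
  interpret R: prob_space R by fact
  interpret S: prob_space "stream_space M" by (rule M.prob_space_stream_space)
  let ?g = "\<lambda>(w, s). (w, smap f s)"
  let ?M = "R \<Otimes>\<^sub>M stream_space M" and ?N = "R \<Otimes>\<^sub>M stream_space N"
  have "prob_space (distr (stream_space M) (stream_space N) (smap f))"
    by (rule S.prob_space_distr) measurable
  hence "distr R R (\<lambda>w. w) \<Otimes>\<^sub>M distr (stream_space M) (stream_space N) (smap f) = distr ?M ?N ?g"
    by (intro pair_measure_distr) (auto intro: prob_space_imp_sigma_finite)
  hence eq: "R \<Otimes>\<^sub>M stream_space (distr M N f) = distr ?M ?N ?g"
    by (simp add: M.stream_space_distr[OF f] distr_id)
  have g: "?g \<in> ?M \<rightarrow>\<^sub>M ?N" by measurable
  obtain E where E: "E \<in> sets (R \<Otimes>\<^sub>M stream_space (distr M N f))"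
    "E \<subseteq> {(w, s). let xs = (\<lambda>i. fst (s !! i)); ys = (\<lambda>i. snd (s !! i));
                          h = out w xs (queried q w xs ys m)
                      in {z \<in> space (distr M N f). h (fst z) \<noteq> snd z} \<in> sets (distr M N f) \<and>
                         err (distr M N f) h \<le> (1 + \<alpha>) * err_class (distr M N f) H}"
    "measure (R \<Otimes>\<^sub>M stream_space (distr M N f)) E \<ge> 1 - \<delta>"
    using assms(4) unfolding al_learns_def by blast
  have E': "E \<in> sets ?N" using E(1) unfolding eq by simp
  show thesis
  proof (rule that[of "?g -` E \<inter> space ?M"])
    show "?g -` E \<inter> space ?M \<in> sets ?M" using g E' by (rule measurable_sets)
    show "measure ?M (?g -` E \<inter> space ?M) \<ge> 1 - \<delta>"
      using E(3) unfolding eq by (simp add: measure_distr[OF g E'])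
    fix w s h assume "(w, s) \<in> ?g -` E \<inter> space ?M"
      and h: "h = out w (\<lambda>i. fst (f (s !! i)))
             (queried q w (\<lambda>i. fst (f (s !! i))) (\<lambda>i. snd (f (s !! i))) m)"
    hence "(w, smap f s) \<in> E" by simp
    thus "{z \<in> space N. h (fst z) \<noteq> snd z} \<in> sets N \<and> err (distr M N f) h \<le> (1 + \<alpha>) * err_class (distr M N f) H"
      using E(2) unfolding h by (auto simp: Let_def)
  qed
qed

section \<open>The hard distributions and their best error\<close>

text \<open>The outcome \<open>Inl (b, k)\<close> is the \<open>k\<close>-th antidiagonal point of block \<open>b\<close>; the outcomes \<open>Inr z\<close>
are the origin with a noisy label.  The points do not depend on \<open>\<sigma>\<close>, so all hard distributions are
images of one sample space with the same unlabelled stream.\<close>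

fun planted_point :: "nat \<Rightarrow> (nat \<times> nat) + bool \<Rightarrow> point" where
  "planted_point N (Inl (b, k)) = (\<lambda>i. if i = 2 * b then real k else if i = 2 * b + 1 then real N - real k else 0)"
| "planted_point N (Inr z) = (\<lambda>i. 0)"

text \<open>Point \<open>k\<close> of block \<open>b\<close> has coordinates \<open>k\<close> and
  \<open>N - k\<close>. The offsets \<open>1 / 2\<close> make it reach the first threshold iff
  \<open>k > \<sigma> b\<close> and the second iff \<open>k < \<sigma> b\<close>, so only
  \<open>k = \<sigma> b\<close> stays negative. For odd \<open>d\<close> the unpaired coordinate
  gets the positive threshold 1, which no planted point reaches.\<close>

definition corner :: "nat \<Rightarrow> nat \<Rightarrow> (nat \<Rightarrow> nat) \<Rightarrow> point" where
  "corner d N \<sigma> i =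
    (if i < 2 * (d div 2) then
       if even i then real (\<sigma> (i div 2)) + 1 / 2 else real N - real (\<sigma> (i div 2)) + 1 / 2
     else if i < d then 1 else 0)"

definition hard_dist ::
    "((nat \<times> nat) + bool) pmf \<Rightarrow> nat \<Rightarrow> (nat \<Rightarrow> nat) \<Rightarrow> (point \<times> int) measure" where
  "hard_dist P N \<sigma> = distr (measure_pmf P) example_space (\<lambda>\<omega>. (planted_point N \<omega>, planted_label \<sigma> \<omega>))"

context
  fixes d N :: nat and \<sigma> :: "nat \<Rightarrow> nat"
  assumes \<sigma>: "\<And>b. b < d div 2 \<Longrightarrow> \<sigma> b < N"
begin

text \<open>Coordinates in which a planted point vanishes never reach their threshold; hence the
  origin is negative, and a point of block \<open>b\<close> is decided by the two coordinates of
  that block.\<close>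

lemma corner_pos:
  assumes "i < d"
  shows "0 < corner d N \<sigma> i"
proof -
  have "i < 2 * (d div 2) \<Longrightarrow> i div 2 < d div 2" by (simp add: less_mult_imp_div_less mult.commute)
  hence "i < 2 * (d div 2) \<Longrightarrow> real (\<sigma> (i div 2)) < real N" using \<sigma> by simp
  thus ?thesis using assms by (auto simp: corner_def)
qed

lemma corner_in_orthant: "corner d N \<sigma> \<in> orthant d"
  using corner_pos by (auto simp: orthant_def less_imp_le) (auto simp: corner_def)

lemma h_box_corner_Inr: "h_box d (corner d N \<sigma>) (planted_point N (Inr z)) = -1"
  using corner_pos by (auto simp: h_box_def not_le[symmetric])

lemma h_box_corner_Inl:
  assumes b: "b < d div 2" and k: "k < N"
  shows "h_box d (corner d N \<sigma>) (planted_point N (Inl (b, k))) = planted_label \<sigma> (Inl (b, k))"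
proof -
  have bd: "2 * b < 2 * (d div 2)" "2 * b + 1 < 2 * (d div 2)" "2 * b < d" "2 * b + 1 < d"
    using b by auto
  have c: "corner d N \<sigma> (2 * b) = real (\<sigma> b) + 1 / 2"
    "corner d N \<sigma> (2 * b + 1) = real N - real (\<sigma> b) + 1 / 2"
    using bd by (auto simp: corner_def)
  have "(\<exists>i<d. planted_point N (Inl (b, k)) i \<ge> corner d N \<sigma> i)
      \<longleftrightarrow> real k \<ge> corner d N \<sigma> (2 * b) \<or> real N - real k \<ge> corner d N \<sigma> (2 * b + 1)"
    (is "?L \<longleftrightarrow> ?R")
  proof (rule iffI)
    assume ?L
    then obtain i where i: "i < d" "planted_point N (Inl (b, k)) i \<ge> corner d N \<sigma> i" by blast
    thus ?R using corner_pos[OF i(1)] by (auto split: if_splits)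
  next
    assume ?R
    thus ?L
    proof
      assume "real k \<ge> corner d N \<sigma> (2 * b)"
      thus ?L using bd by (intro exI[of _ "2 * b"]) simp
    next
      assume "real N - real k \<ge> corner d N \<sigma> (2 * b + 1)"
      thus ?L using bd by (intro exI[of _ "2 * b + 1"]) simp
    qed
  qed
  also have "?R \<longleftrightarrow> \<sigma> b \<noteq> k" unfolding c by linarith
  finally show ?thesis by (auto simp: h_box_def)
qed

end

lemma measurable_h_box [measurable]:
  "h_box d a \<in> (\<Pi>\<^sub>M i\<in>UNIV. (borel :: real measure)) \<rightarrow>\<^sub>M count_space UNIV"
  unfolding h_box_def[abs_def] by measurable

lemma space_example_space [simp]: "space example_space = UNIV"
  by (simp add: example_space_def space_pair_measure space_PiM)

lemma measurable_fst_example_space [measurable]: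
  "fst \<in> example_space \<rightarrow>\<^sub>M (\<Pi>\<^sub>M i\<in>UNIV. (borel :: real measure))"
  unfolding example_space_def by measurable

lemma measurable_snd_example_space [measurable]:
  "snd \<in> example_space \<rightarrow>\<^sub>M count_space UNIV"
  unfolding example_space_def by measurable

lemma h_box_error_set: "{z \<in> space example_space. h_box d a (fst z) \<noteq> snd z} \<in> sets example_space"
  by measurable

lemma planted_example_measurable: "(\<lambda>\<omega>. (planted_point N \<omega>, planted_label \<sigma> \<omega>)) \<in> measure_pmf P \<rightarrow>\<^sub>M example_space"
  by simp

lemma err_hard_dist:
  assumes "{z \<in> space example_space. h (fst z) \<noteq> snd z} \<in> sets example_space"
  shows "err (hard_dist P N \<sigma>) h = measure_pmf.prob P {\<omega>. h (planted_point N \<omega>) \<noteq> planted_label \<sigma> \<omega>}"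
  using assms unfolding err_def hard_dist_def
  by (subst measure_distr) (auto simp: vimage_def)

lemma orthant_sets: "orthant d \<in> sets (\<Pi>\<^sub>M i\<in>UNIV. (borel :: real measure))"
proof -
  have "{x \<in> space (\<Pi>\<^sub>M i\<in>UNIV. (borel :: real measure)).
      (\<forall>i<d. 0 \<le> x i) \<and> (\<forall>i. d \<le> i \<longrightarrow> x i = 0)} \<in> sets (\<Pi>\<^sub>M i\<in>UNIV. (borel :: real measure))"
    by measurable
  thus ?thesis by (simp add: orthant_def space_PiM)
qed

lemma planted_label_cases: "planted_label \<sigma> \<omega> = -1 \<or> planted_label \<sigma> \<omega> = 1"
  by (cases "(\<sigma>, \<omega>)" rule: planted_label.cases) auto

lemma valid_hard_dist:
  assumes P: "set_pmf P \<subseteq> Inl ` ({..<d div 2} \<times> {..<N}) \<union> range Inr"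
  shows "valid_dist d (hard_dist P N \<sigma>)"
proof -
  have "planted_point N \<omega> \<in> orthant d" if "\<omega> \<in> set_pmf P" for \<omega>
  proof -
    have "\<omega> \<in> Inl ` ({..<d div 2} \<times> {..<N}) \<union> range Inr" using P that by blast
    thus ?thesis by (auto simp: orthant_def)
  qed
  moreover have "{z \<in> space example_space. fst z \<in> orthant d \<and> snd z \<in> {-1, 1}} \<in> sets example_space"
  proof -
    have "fst -` orthant d \<inter> space example_space \<inter> (snd -` {-1, 1} \<inter> space example_space)
        \<in> sets example_space"
      by (intro sets.Int measurable_sets[OF measurable_fst_example_space]
            measurable_sets[OF measurable_snd_example_space] orthant_sets) simp
    thus ?thesis by (simp add: vimage_def Int_def)
  qed
  ultimately have "AE z in hard_dist P N \<sigma>. fst z \<in> orthant d \<and> snd z \<in> {-1, 1}"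
    unfolding hard_dist_def using planted_label_cases
    by (subst AE_distr_iff) (auto simp: AE_measure_pmf_iff)
  thus ?thesis
    unfolding valid_dist_def
    by (auto simp: hard_dist_def intro!: measure_pmf.prob_space_distr)
qed

text \<open>The two outcomes at the origin have opposite labels, so every hypothesis errs on one of
  them, and each has mass at least \<open>\<eta>\<close>. On the support, the corner hypothesis errs
  only on \<open>Inr True\<close>.\<close>

lemma err_class_hard_dist:
  assumes P: "set_pmf P \<subseteq> Inl ` ({..<d div 2} \<times> {..<N}) \<union> range Inr"
    and \<sigma>: "\<And>b. b < d div 2 \<Longrightarrow> \<sigma> b < N"
    and noise: "pmf P (Inr True) = \<eta>" "\<eta> \<le> pmf P (Inr False)"
  shows "err_class (hard_dist P N \<sigma>) (H_box d) = \<eta>"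
proof -
  let ?E = "\<lambda>h. {\<omega>. h (planted_point N \<omega>) \<noteq> planted_label \<sigma> \<omega>}"
  let ?h = "h_box d (corner d N \<sigma>)"
  have err: "err (hard_dist P N \<sigma>) h = measure_pmf.prob P (?E h)" if h: "h \<in> H_box d" for h
  proof -
    obtain a where "h = h_box d a" using h unfolding H_box_def by blast
    thus ?thesis by (simp only: err_hard_dist[OF h_box_error_set])
  qed
  have lower: "\<eta> \<le> err (hard_dist P N \<sigma>) h" if h: "h \<in> H_box d" for h
  proof -
    \<comment> \<open>\<open>Inr z\<close> is the outcome at the origin that \<open>h\<close> gets
      wrong.\<close>
    define z where "z = (h (\<lambda>i. 0) \<noteq> 1)"
    have "Inr z \<in> ?E h" by (simp add: z_def)
    hence "measure_pmf.prob P {Inr z} \<le> measure_pmf.prob P (?E h)"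
      by (intro measure_pmf.finite_measure_mono) auto
    thus ?thesis using noise by (cases z) (auto simp: err[OF h] measure_pmf_single)
  qed
  have h: "?h \<in> H_box d" using corner_in_orthant[of d \<sigma> N] \<sigma> by (auto simp: H_box_def)
  have "?E ?h \<inter> set_pmf P \<subseteq> {Inr True}"
  proof
    fix \<omega> assume \<omega>: "\<omega> \<in> ?E ?h \<inter> set_pmf P"
    hence "\<omega> \<in> Inl ` ({..<d div 2} \<times> {..<N}) \<union> range Inr" using P by blast
    thus "\<omega> \<in> {Inr True}"
      using \<omega> h_box_corner_Inl[of d \<sigma> N, OF \<sigma>] h_box_corner_Inr[of d \<sigma> N, OF \<sigma>]
      by (auto simp del: planted_label.simps(1) planted_point.simps split: if_splits)
  qed
  hence "measure_pmf.prob P (?E ?h \<inter> set_pmf P) \<le> measure_pmf.prob P {Inr True}"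
    by (intro measure_pmf.finite_measure_mono) auto
  hence upper: "err (hard_dist P N \<sigma>) ?h \<le> \<eta>"
    using noise by (simp add: err[OF h] measure_pmf_single measure_Int_set_pmf)
  show ?thesis unfolding err_class_def
  proof (rule antisym)
    show "(INF h\<in>H_box d. err (hard_dist P N \<sigma>) h) \<le> \<eta>"
    proof (rule order_trans[OF _ upper])
      have "bdd_below (err (hard_dist P N \<sigma>) ` H_box d)"
        using lower by (auto intro!: bdd_belowI[of _ \<eta>])
      thus "(INF h\<in>H_box d. err (hard_dist P N \<sigma>) h) \<le> err (hard_dist P N \<sigma>) ?h"
        using h by (rule cINF_lower)
    qed
    show "\<eta> \<le> (INF h\<in>H_box d. err (hard_dist P N \<sigma>) h)"
      using h lower by (intro cINF_greatest) auto
  qed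
qed

section \<open>Reading a guess for \<open>\<sigma>\<close> off a hypothesis\<close>

text \<open>If the block has no unique negative point, the value is unspecified; \<open>h\<close>
  then errs in that block whatever \<open>\<sigma> b\<close> is, so no case distinction is
  needed.\<close>

definition guess :: "nat \<Rightarrow> (point \<Rightarrow> int) \<Rightarrow> nat \<Rightarrow> nat" where
  "guess N h b = (THE k. k < N \<and> h (planted_point N (Inl (b, k))) = -1)"

text \<open>A hypothesis that is right on all \<open>N\<close> points of a block yields the guess
  \<open>\<sigma> b\<close>. So each wrongly guessed block contains a misclassified point of mass
  \<open>p\<close>, and these points are distinct.\<close>

lemma wrong_guesses_le_prob:
  assumes P: "\<And>b k. b < B \<Longrightarrow> k < N \<Longrightarrow> pmf P (Inl (b, k)) = p"
    and \<sigma>: "\<And>b. b < B \<Longrightarrow> \<sigma> b < N"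
  shows "p * real (card {b. b < B \<and> guess N h b \<noteq> \<sigma> b})
      \<le> measure_pmf.prob P {\<omega>. h (planted_point N \<omega>) \<noteq> planted_label \<sigma> \<omega>}"
proof -
  let ?W = "{b. b < B \<and> guess N h b \<noteq> \<sigma> b}"
  have "\<exists>k<N. h (planted_point N (Inl (b, k))) \<noteq> planted_label \<sigma> (Inl (b, k))" if b: "b \<in> ?W" for b
  proof (rule ccontr)
    assume "\<not> ?thesis"
    hence eq: "h (planted_point N (Inl (b, k))) = (if \<sigma> b = k then -1 else 1)" if "k < N" for k
      using that by auto
    have "guess N h b = \<sigma> b" unfolding guess_def
    proof (rule the_equality)
      show "\<sigma> b < N \<and> h (planted_point N (Inl (b, \<sigma> b))) = -1" using b \<sigma> eq[of "\<sigma> b"] by simp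
      show "k = \<sigma> b" if "k < N \<and> h (planted_point N (Inl (b, k))) = -1" for k
        using that eq[of k] by (simp split: if_splits)
    qed
    thus False using b by simp
  qed
  then obtain \<kappa> where \<kappa>: "\<And>b. b \<in> ?W \<Longrightarrow>
      \<kappa> b < N \<and> h (planted_point N (Inl (b, \<kappa> b))) \<noteq> planted_label \<sigma> (Inl (b, \<kappa> b))" by metis
  let ?f = "\<lambda>b. Inl (b, \<kappa> b) :: (nat \<times> nat) + bool"
  have "p * real (card ?W) = (\<Sum>b\<in>?W. pmf P (?f b))"
    using \<kappa> P by simp
  also have "\<dots> = (\<Sum>\<omega>\<in>?f ` ?W. pmf P \<omega>)"
    by (subst sum.reindex) (auto simp: inj_on_def)
  also have "\<dots> = measure_pmf.prob P (?f ` ?W)"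
    by (intro measure_measure_pmf_finite[symmetric]) auto
  also have "\<dots> \<le> measure_pmf.prob P {\<omega>. h (planted_point N \<omega>) \<noteq> planted_label \<sigma> \<omega>}"
    using \<kappa> by (intro measure_pmf.finite_measure_mono) (auto simp del: planted_label.simps planted_point.simps)
  finally show ?thesis .
qed

section \<open>The masses, the counting argument and the choice of parameters\<close>

lemma hard_pmf_exists:
  fixes p \<eta> :: real
  assumes "0 \<le> p" "0 \<le> \<eta>" "real B * real N * p + \<eta> \<le> 1"
  obtains P :: "((nat \<times> nat) + bool) pmf" where
    "set_pmf P \<subseteq> Inl ` ({..<B} \<times> {..<N}) \<union> range Inr"
    "\<And>b k. b < B \<Longrightarrow> k < N \<Longrightarrow> pmf P (Inl (b, k)) = p"
    "pmf P (Inr True) = \<eta>" "pmf P (Inr False) = 1 - \<eta> - real B * real N * p"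
proof -
  define f :: "(nat \<times> nat) + bool \<Rightarrow> real" where
    "f = case_sum (\<lambda>bk. if bk \<in> {..<B} \<times> {..<N} then p else 0)
           (\<lambda>z. if z then \<eta> else 1 - \<eta> - real B * real N * p)"
  let ?S = "({..<B} \<times> {..<N}) <+> (UNIV :: bool set)"
  have nonneg: "0 \<le> f x" for x using assms by (auto simp: f_def split: sum.split)
  have "(\<integral>\<^sup>+x. ennreal (f x) \<partial>count_space UNIV) = (\<Sum>x\<in>?S. ennreal (f x))"
    by (rule nn_integral_count_space') (auto simp: f_def split: sum.split)
  also have "\<dots> = ennreal (\<Sum>x\<in>?S. f x)" using nonneg by simp
  also have "(\<Sum>x\<in>?S. f x) = 1"
    by (subst sum.Plus) (auto simp: f_def UNIV_bool)
  finally have int: "(\<integral>\<^sup>+x. ennreal (f x) \<partial>count_space UNIV) = 1" by simp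
  have pmf: "pmf (embed_pmf f) x = f x" for x by (rule pmf_embed_pmf[OF nonneg int])
  show thesis
  proof (rule that[of "embed_pmf f"])
    show "set_pmf (embed_pmf f) \<subseteq> Inl ` ({..<B} \<times> {..<N}) \<union> range Inr"
    proof
      fix x assume "x \<in> set_pmf (embed_pmf f)"
      hence "f x \<noteq> 0" by (simp add: set_pmf_iff pmf)
      thus "x \<in> Inl ` ({..<B} \<times> {..<N}) \<union> range Inr"
        by (cases x) (auto simp: f_def split: if_splits)
    qed
  qed (simp_all only: pmf, simp_all add: f_def)
qed


text \<open>Markov's inequality. With all \<open>N\<close> candidates per block the potential is
  \<open>2 / N\<close>, so the mean number of correct guesses is at most
  \<open>2 * B / N + 2 * m / N\<close>. The two factors 16 bound each summand by
  \<open>B / 8\<close>, and at least \<open>B / 2\<close> correct guesses can then occur for at most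
  half of all \<open>\<sigma>\<close>.\<close>

lemma card_learned_le_half:
  fixes B N m :: nat
  assumes B: "0 < B" and N: "16 \<le> N" and m: "16 * m \<le> B * N"
    and C: "C \<subseteq> PiE {..<B} (\<lambda>_. {..<N})"
    and right: "\<And>\<sigma>. \<sigma> \<in> C \<Longrightarrow>
      real B / 2 \<le> real (card {b\<in>{..<B}. g (queried q w xs (\<lambda>i. planted_label \<sigma> (loc i)) m) b = \<sigma> b})"
  shows "real (card C) \<le> real (card (PiE {..<B} (\<lambda>_. {..<N}))) / 2"
proof -
  let ?\<Sigma> = "PiE {..<B} (\<lambda>_. {..<N})"
  let ?r = "\<lambda>\<sigma>. real (card {b\<in>{..<B}. g (queried q w xs (\<lambda>i. planted_label \<sigma> (loc i)) m) b = \<sigma> b})"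
  have N0: "0 < real N" using N by simp
  have "real (card C) * (real B / 2) \<le> (\<Sum>\<sigma>\<in>C. ?r \<sigma>)"
    using right by (intro sum_bounded_below)
  also have "\<dots> \<le> (\<Sum>\<sigma>\<in>?\<Sigma>. ?r \<sigma>)"
    using C by (intro sum_mono2) (auto intro!: finite_PiE)
  also have "\<dots> \<le> real (card ?\<Sigma>) * ((\<Sum>b\<in>{..<B}. 1 + (2 - real (card {..<N})) / real N) + 2 * real m / real N)"
    using N N0 by (intro sum_correct_guess_adaptive_le) (auto simp: lessThan_empty_iff)
  also have "\<dots> \<le> real (card ?\<Sigma>) * (real B / 4)"
  proof (intro mult_left_mono)
    have m': "16 * real m \<le> real B * real N" using m by (metis of_nat_le_iff of_nat_mult of_nat_numeral)
    have "real B * 16 \<le> real B * real N" using N by (intro mult_left_mono) auto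
    hence "8 * real B + 8 * real m \<le> real B * real N" using m' by linarith
    thus "(\<Sum>b\<in>{..<B}. 1 + (2 - real (card {..<N})) / real N) + 2 * real m / real N \<le> real B / 4"
      using N0 by (simp add: field_simps)
  qed simp
  finally show ?thesis using B by (simp add: field_simps)
qed

text \<open>The bound on \<open>p\<close> makes an error of \<open>(1 + \<alpha>) * \<eta>\<close>
  pay for at most half of the blocks being wrong; the bound on the total mass leaves at least
  \<open>\<eta>\<close> for \<open>Inr False\<close>. With too few queries, the success probability
  averaged over \<open>\<sigma>\<close> would be at most \<open>1 / 2\<close>, below
  \<open>1 - \<delta>\<close>.\<close>

lemma label_complexity_lower_bound:
  fixes \<alpha> \<delta> \<eta> p :: real and d N m :: nat
  assumes B: "0 < d div 2" and \<delta>: "\<delta> < 1/2" and p: "0 < p" "2 * (1 + \<alpha>) * \<eta> \<le> p * real (d div 2)"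
    and \<eta>: "0 < \<eta>" "real (d div 2) * real N * p + 2 * \<eta> \<le> 1" and N: "16 \<le> N"
    and R: "prob_space R"
    and learns: "\<And>D. valid_dist d D \<Longrightarrow> err_class D (H_box d) = \<eta> \<Longrightarrow>
      al_learns R q out m (H_box d) \<alpha> \<delta> D"
  shows "(d div 2) * N < 16 * m"
proof (rule ccontr)
  define B where "B = d div 2"
  let ?\<Sigma> = "PiE {..<B} (\<lambda>_. {..<N})"
  assume "\<not> ?thesis"
  hence m: "16 * m \<le> B * N" by (simp add: B_def)
  have "real B * real N * p + \<eta> \<le> 1" using \<eta> by (simp add: B_def)
  then obtain P :: "((nat \<times> nat) + bool) pmf" where
    P: "set_pmf P \<subseteq> Inl ` ({..<B} \<times> {..<N}) \<union> range Inr"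
    "\<And>b k. b < B \<Longrightarrow> k < N \<Longrightarrow> pmf P (Inl (b, k)) = p"
    "pmf P (Inr True) = \<eta>" "pmf P (Inr False) = 1 - \<eta> - real B * real N * p"
    using hard_pmf_exists[of p \<eta> B N] p(1) \<eta>(1) by (metis less_imp_le)
  let ?M = "R \<Otimes>\<^sub>M stream_space (measure_pmf P)"
  \<comment> \<open>The unlabelled stream is the same function of \<open>s\<close> for every
    \<open>\<sigma>\<close>; only the labels vary.\<close>
  let ?xs = "\<lambda>s i. planted_point N (s !! i)" and ?ys = "\<lambda>\<sigma> s i. planted_label \<sigma> (s !! i)"
  let ?g = "\<lambda>w s \<sigma>. guess N (out w (?xs s) (queried q w (?xs s) (?ys \<sigma> s) m))"
  define good where "good \<sigma> F \<longleftrightarrow> F \<in> sets ?M \<and> measure ?M F \<ge> 1 - \<delta> \<and>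
      (\<forall>w s. (w, s) \<in> F \<longrightarrow> real B / 2 \<le> real (card {b\<in>{..<B}. ?g w s \<sigma> b = \<sigma> b}))" for \<sigma> F
  have "\<exists>F. good \<sigma> F"
    if \<sigma>: "\<sigma> \<in> ?\<Sigma>" for \<sigma>
  proof -
    have \<sigma>N: "\<sigma> b < N" if "b < B" for b using \<sigma> that by (auto simp: PiE_iff)
    have opt: "err_class (hard_dist P N \<sigma>) (H_box d) = \<eta>"
      using P \<sigma>N \<eta> by (intro err_class_hard_dist) (auto simp: B_def)
    have "al_learns R q out m (H_box d) \<alpha> \<delta> (hard_dist P N \<sigma>)"
      using P by (intro learns valid_hard_dist opt) (simp add: B_def)
    then obtain F where F: "F \<in> sets ?M" "measure ?M F \<ge> 1 - \<delta>"
      "\<And>w s h. (w, s) \<in> F \<Longrightarrow> h = out w (?xs s) (queried q w (?xs s) (?ys \<sigma> s) m) \<Longrightarrow>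
         {z \<in> space example_space. h (fst z) \<noteq> snd z} \<in> sets example_space \<and>
         err (hard_dist P N \<sigma>) h \<le> (1 + \<alpha>) * err_class (hard_dist P N \<sigma>) (H_box d)"
      using al_learns_distrE[OF measure_pmf.prob_space_axioms R planted_example_measurable,
          where q = q and out = out and m = m and H = "H_box d" and \<alpha> = \<alpha> and \<delta> = \<delta>]
      unfolding hard_dist_def fst_conv snd_conv by blast
    have "real B / 2 \<le> real (card {b\<in>{..<B}. ?g w s \<sigma> b = \<sigma> b})" if ws: "(w, s) \<in> F" for w s
    proof -
      define h where "h = out w (?xs s) (queried q w (?xs s) (?ys \<sigma> s) m)"
      let ?W = "{b. b < B \<and> guess N h b \<noteq> \<sigma> b}" and ?G = "{b\<in>{..<B}. guess N h b = \<sigma> b}"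
      have h: "{z \<in> space example_space. h (fst z) \<noteq> snd z} \<in> sets example_space"
        "err (hard_dist P N \<sigma>) h \<le> (1 + \<alpha>) * \<eta>"
        using F(3)[OF ws h_def] opt by auto
      have "p * real (card ?W) \<le> measure_pmf.prob P {\<omega>. h (planted_point N \<omega>) \<noteq> planted_label \<sigma> \<omega>}"
        using P(2) \<sigma>N by (intro wrong_guesses_le_prob) auto
      also have "\<dots> \<le> p * (real B / 2)"
        using h(2) p(2) unfolding err_hard_dist[OF h(1)] B_def by (simp add: algebra_simps)
      finally have W: "real (card ?W) \<le> real B / 2" using p(1) by simp
      have "card ?G + card ?W = card (?G \<union> ?W)" by (rule card_Un_disjoint[symmetric]) auto
      also have "?G \<union> ?W = {..<B}" by auto
      finally have "real (card ?G) + real (card ?W) = real B" by simp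
      thus ?thesis using W unfolding h_def by linarith
    qed
    thus ?thesis unfolding good_def using F by blast
  qed
  then obtain F where "\<And>\<sigma>. \<sigma> \<in> ?\<Sigma> \<Longrightarrow> good \<sigma> (F \<sigma>)" by metis
  hence F: "\<And>\<sigma>. \<sigma> \<in> ?\<Sigma> \<Longrightarrow> F \<sigma> \<in> sets ?M"
    "\<And>\<sigma>. \<sigma> \<in> ?\<Sigma> \<Longrightarrow> measure ?M (F \<sigma>) \<ge> 1 - \<delta>"
    "\<And>\<sigma> w s. \<sigma> \<in> ?\<Sigma> \<Longrightarrow> (w, s) \<in> F \<sigma> \<Longrightarrow> real B / 2 \<le> real (card {b\<in>{..<B}. ?g w s \<sigma> b = \<sigma> b})"
    unfolding good_def by simp_all
  have fin: "finite ?\<Sigma>" by (auto intro!: finite_PiE)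
  interpret R: prob_space R by fact
  interpret S: prob_space "stream_space (measure_pmf P)"
    by (rule prob_space.prob_space_stream_space[OF measure_pmf.prob_space_axioms])
  interpret M: pair_prob_space R "stream_space (measure_pmf P)" ..
  \<comment> \<open>Seed and stream are now fixed, and the guessing bound applies with
    \<open>s !! i\<close> as the outcome behind index \<open>i\<close>.\<close>
  have "real (card {\<sigma>\<in>?\<Sigma>. x \<in> F \<sigma>}) \<le> real (card ?\<Sigma>) / 2" for x
  proof (cases x)
    case (Pair w s)
    show ?thesis
    proof (rule card_learned_le_half[where g = "\<lambda>ls. guess N (out w (?xs s) ls)" and q = q
          and w = w and xs = "?xs s" and loc = "\<lambda>i. s !! i" and m = m])
      fix \<sigma> assume "\<sigma> \<in> {\<sigma>\<in>?\<Sigma>. x \<in> F \<sigma>}"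
      thus "real B / 2 \<le> real (card {b\<in>{..<B}. ?g w s \<sigma> b = \<sigma> b})"
        using F(3)[of \<sigma> w s] Pair by simp
    qed (use B N m in \<open>auto simp: B_def\<close>)
  qed
  hence "(\<Sum>\<sigma>\<in>?\<Sigma>. measure ?M (F \<sigma>)) \<le> real (card ?\<Sigma>) / 2"
    using fin F(1) by (intro M.sum_prob_le)
  moreover have "real (card ?\<Sigma>) * (1 - \<delta>) \<le> (\<Sum>\<sigma>\<in>?\<Sigma>. measure ?M (F \<sigma>))"
    using F(2) by (intro sum_bounded_below)
  moreover have "real (card ?\<Sigma>) * (1 / 2) < real (card ?\<Sigma>) * (1 - \<delta>)"
    using \<delta> N by (intro mult_strict_left_mono) (auto simp: card_PiE)
  ultimately show False by simp
qed

theorem theorem5: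
  fixes \<alpha> \<delta> :: real
  assumes "\<alpha> > 0" and "0 < \<delta>" and "\<delta> < 1/2"
  shows "\<exists>c>0. \<exists>d0::nat. \<exists>\<eta>0>0. \<forall>d\<ge>d0. \<forall>\<eta>::real. 0 < \<eta> \<and> \<eta> \<le> \<eta>0 \<longrightarrow>
           (\<forall>(R :: real measure) q out (m::nat).
              prob_space R \<and>
              (\<forall>D. valid_dist d D \<and> err_class D (H_box d) = \<eta> \<longrightarrow>
                   al_learns R q out m (H_box d) \<alpha> \<delta> D)
              \<longrightarrow> real m \<ge> c * real d / \<eta>)"
proof (intro exI conjI allI impI)
  \<comment> \<open>The bound \<open>\<eta> \<le> 1 / (64 * (1 + \<alpha>))\<close> gives
    \<open>16 \<le> X\<close> below. The constant 512 is 16 from the counting bound, times 4 from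
    \<open>d \<le> 4 * B\<close>, times 2 from rounding \<open>X\<close> down, times the 4 in
    \<open>X\<close>.\<close>
  show "1 / (512 * (1 + \<alpha>)) > 0" "1 / (64 * (1 + \<alpha>)) > 0" using assms by auto
  fix d m :: nat and \<eta> :: real and R :: "real measure" and q out
  assume d: "2 \<le> d" and "0 < \<eta> \<and> \<eta> \<le> 1 / (64 * (1 + \<alpha>))"
    and "prob_space R \<and> (\<forall>D. valid_dist d D \<and> err_class D (H_box d) = \<eta> \<longrightarrow>
                   al_learns R q out m (H_box d) \<alpha> \<delta> D)"
  hence \<eta>: "0 < \<eta>" "\<eta> \<le> 1 / (64 * (1 + \<alpha>))" and R: "prob_space R"
    and learns: "\<And>D. valid_dist d D \<Longrightarrow> err_class D (H_box d) = \<eta> \<Longrightarrow>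
                   al_learns R q out m (H_box d) \<alpha> \<delta> D" by auto
  \<comment> \<open>Chosen so that the planted points have total mass at most
    \<open>X * 2 * (1 + \<alpha>) * \<eta> = 1 / 2\<close>, which leaves room for the noise.\<close>
  define X where "X = 1 / (4 * (1 + \<alpha>) * \<eta>)"
  define N where "N = nat \<lfloor>X\<rfloor>"
  define B where "B = d div 2"
  define p where "p = 2 * (1 + \<alpha>) * \<eta> / real B"
  have B: "0 < B" "real d \<le> 4 * real B" using d by (auto simp: B_def)
  have pos: "0 < 4 * (1 + \<alpha>) * \<eta>" using \<eta> assms by simp
  have "16 * (4 * (1 + \<alpha>) * \<eta>) \<le> 1" using \<eta> assms by (simp add: field_simps)
  hence X16: "16 \<le> X" using pos by (simp only: X_def pos_le_divide_eq)
  hence N: "16 \<le> N" "real N \<le> X" "X / 2 \<le> real N"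
    unfolding N_def by (simp_all add: le_nat_iff le_floor_iff) linarith+
  have "\<eta> * 64 \<le> \<eta> * (64 * (1 + \<alpha>))" using \<eta> assms by (intro mult_left_mono) auto
  also have "\<dots> \<le> 1" using \<eta> assms by (simp add: field_simps)
  finally have \<eta>64: "\<eta> \<le> 1 / 64" by simp
  have "real B * real N * p = real N * (2 * (1 + \<alpha>) * \<eta>)" using B by (simp add: p_def)
  also have "\<dots> \<le> X * (2 * (1 + \<alpha>) * \<eta>)" using N \<eta> assms by (intro mult_right_mono) auto
  also have "\<dots> = X * (4 * (1 + \<alpha>) * \<eta>) / 2" by simp
  also have "\<dots> = 1 / 2" using \<eta> assms by (simp add: X_def)
  finally have "real B * real N * p + 2 * \<eta> \<le> 1" using \<eta>64 by simp
  moreover have "0 < p" "2 * (1 + \<alpha>) * \<eta> \<le> p * real B" using B \<eta> assms by (auto simp: p_def)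
  ultimately have "B * N < 16 * m"
    unfolding B_def using B N(1) \<eta> assms R learns
    by (intro label_complexity_lower_bound[where \<delta> = \<delta> and \<alpha> = \<alpha> and p = p and R = R and q = q and out = out])
      (auto simp: B_def)
  hence BN: "real B * real N < 16 * real m" by (metis of_nat_less_iff of_nat_mult of_nat_numeral)
  have "1 / (512 * (1 + \<alpha>)) * real d / \<eta> = real d * X / 128"
    by (simp add: X_def)
  also have "\<dots> \<le> (4 * real B) * (2 * real N) / 128"
    using B N X16 by (intro divide_right_mono mult_mono) auto
  also have "\<dots> \<le> real m" using BN by simp
  finally show "real m \<ge> 1 / (512 * (1 + \<alpha>)) * real d / \<eta>" .
qed

end
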